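(* Let $\mu$ be a non-trivial probability measure supported on $[-1,1]$, $\sigma=\mathrm{Sz}(\mu)$ its Szegő transformation, and $F$ the $\mathcal C$-function of $\sigma$. Let $k\ge1$ be an integer and let $\hat F^{(k)}$ be the $\mathcal C$-function corresponding, through the Szegő transformation, to the associated polynomials of order $k$, $\{P_n^{(k)}\}_{n\ge 0}$. Then $$\frac{2z}{1-z^2}\hat F^{(k)}(z)\ \dot{=}\ \boldsymbol B^{(k)}\!\left(\frac{z+z^{-1}}{2}\right)\left(\frac{2z}{1-z^2}F(z)\right),$$ where $$\boldsymbol B^{(k)}(x)=\begin{bmatrix}P_k(x)&-P^{(1)}_{k-1}(x)\\ d_kP_{k-1}(x)&-d_kP^{(1)}_{k-2}(x)\end{bmatrix},\qquad 2x=z+z^{-1}.$$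
   Context: Notation $\dot=$: for a $2\times2$ matrix of functions, $f\ \dot=\ \begin{bmatrix}a&b\\c&d\end{bmatrix}g$ means $f=\dfrac{a g+b}{c g+d}$ (homography). The monic orthogonal polynomials $P_n$ of $\mu$ satisfy $P_{n+1}(x)=(x-b_{n+1})P_n(x)-d_nP_{n-1}(x)$, $n\ge0$, $P_{-1}=0$, $P_0=1$, with $b_n\in\mathbb R$, $d_n>0$ for $n\ge1$. The associated polynomials of order $k$ satisfy $P^{(k)}_{n+1}(x)=(x-b_{n+k+1})P^{(k)}_n(x)-d_{n+k}P^{(k)}_{n-1}(x)$, $n\ge 0$, $P^{(k)}_{-1}=0$, $P^{(k)}_0=1$; they are the monic orthogonal polynomials of a probability measure $\mu^{(k)}$ supported on $[-1,1]$. Szegő transformation: a probability measure $\nu$ on $[-1,1]$ is sent to the probability measure $\mathrm{Sz}(\nu)$ on the unit circle given by $d\,\mathrm{Sz}(\nu)(\theta)=\frac12|d\nu(\cos\theta)|$, i.e. the measure invariant under $\theta\mapsto-\theta$ whose push-forward under $e^{i\theta}\mapsto\cos\theta$ is $\nu$. The $\mathcal C$-function of a probability measure $\sigma$ on the unit circle is $F_\sigma(z)=\int_{-\pi}^{\pi}\frac{e^{i\theta}+z}{e^{i\theta}-z}\,d\sigma(\theta)$, $|z|<1$. Here $\hat F^{(k)}$ is the $\mathcal C$-function of $\mathrm{Sz}(\mu^{(k)})$. The variable $z$ ranges over $0<|z|<1$, so that $x=(z+z^{-1})/2\in\mathbb C\setminus[-1,1]$. *)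

theory Defs
  imports "HOL-Analysis.Analysis" "HOL-Probability.Probability" "HOL-Computational_Algebra.Polynomial"
begin

definition prob_measure_on :: "'a::topological_space set \<Rightarrow> 'a measure \<Rightarrow> bool" where
  "prob_measure_on S \<nu> \<longleftrightarrow> prob_space \<nu> \<and> sets \<nu> = sets borel \<and> (AE x in \<nu>. x \<in> S)"

definition measure_support :: "'a::topological_space measure \<Rightarrow> 'a set" where
  "measure_support \<nu> = {x. \<forall>U. open U \<longrightarrow> x \<in> U \<longrightarrow> emeasure \<nu> U > 0}"

definition nontrivial_measure :: "'a::topological_space measure \<Rightarrow> bool" where
  "nontrivial_measure \<nu> \<longleftrightarrow> infinite (measure_support \<nu>)"

text \<open>Measures on the unit circle are Borel measures on the complex plane concentrated on
  \<open>sphere 0 1\<close>. Half of the mass of \<open>\<nu>\<close> is moved to the upper semicircle and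
  half to the lower one, which is \<open>d\<sigma>(\<theta>) = 1/2 |d\<nu>(cos \<theta>)|\<close>; points \<open>x\<close> outside
  \<open>[-1,1]\<close>, where \<open>arccos\<close> is arbitrary, are \<open>\<nu>\<close>-null in all uses. The theorem
  \<open>szego_iff\<close> below characterises the result by its conjugation invariance and its image under
  \<open>Re\<close>, that is, under \<open>e\<^sup>i\<^sup>\<theta> \<mapsto> cos \<theta>\<close>.\<close>

definition szego :: "real measure \<Rightarrow> complex measure" where
  "szego \<nu> = measure_of UNIV (sets borel)
     (\<lambda>A. (emeasure (distr \<nu> borel (\<lambda>x. cis (arccos x))) A
          + emeasure (distr \<nu> borel (\<lambda>x. cis (- arccos x))) A) / 2)"

lemma sets_szego [simp, measurable_cong]: "sets (szego \<nu>) = sets borel"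
  unfolding szego_def using sets.sigma_sets_eq[of "borel :: complex measure"] by simp

lemma space_szego [simp]: "space (szego \<nu>) = UNIV"
  using sets_eq_imp_space_eq[OF sets_szego] by simp

lemma borel_measurable_arccos [measurable]: "arccos \<in> borel_measurable borel"
proof -
  have out: "arccos x = arccos 2" if "x \<notin> {-1..1}" for x :: real
  proof -
    have "\<not> (0 \<le> y \<and> y \<le> pi \<and> cos y = x)" for y
      using that by auto
    moreover have "\<not> (0 \<le> y \<and> y \<le> pi \<and> cos y = 2)" for y :: real
      using cos_le_one[of y] by linarith
    ultimately have "(\<lambda>y. 0 \<le> y \<and> y \<le> pi \<and> cos y = x) = (\<lambda>y. 0 \<le> y \<and> y \<le> pi \<and> cos y = 2)"
      by blast
    then show ?thesis
      unfolding arccos_def by (rule arg_cong)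
  qed
  have "arccos = (\<lambda>x. if x \<in> {-1..1} then arccos x else arccos 2)"
    by (rule ext) (metis out)
  also have "\<dots> \<in> borel_measurable borel"
    by (rule borel_measurable_continuous_on_if) (auto intro: continuous_on_arccos')
  finally show ?thesis .
qed

lemma borel_measurable_cis [measurable]: "cis \<in> borel_measurable borel"
  by (intro borel_measurable_continuous_onI continuous_intros)

lemma emeasure_szego:
  assumes A: "A \<in> sets borel"
  shows "emeasure (szego \<nu>) A = (emeasure (distr \<nu> borel (\<lambda>x. cis (arccos x))) A
          + emeasure (distr \<nu> borel (\<lambda>x. cis (- arccos x))) A) / 2"
  unfolding szego_def
proof (rule emeasure_measure_of_sigma)
  show "sigma_algebra UNIV (sets (borel :: complex measure))"
    using sets.sigma_algebra_axioms[of "borel :: complex measure"] by simp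
  show "countably_additive (sets borel)
     (\<lambda>A. (emeasure (distr \<nu> borel (\<lambda>x. cis (arccos x))) A
          + emeasure (distr \<nu> borel (\<lambda>x. cis (- arccos x))) A) / 2)"
    unfolding countably_additive_def
    by (auto simp: suminf_emeasure ennreal_suminf_divide suminf_add[symmetric])
qed (use A in \<open>auto simp: positive_def\<close>)

theorem szego_iff:
  assumes \<nu>: "prob_measure_on {-1..1} \<nu>"
  shows "\<sigma> = szego \<nu> \<longleftrightarrow>
    prob_measure_on (sphere 0 1) \<sigma> \<and> distr \<sigma> borel cnj = \<sigma> \<and> distr \<sigma> borel Re = \<nu>"
proof -
  have [measurable_cong, simp]: "sets \<nu> = sets borel" and ps: "prob_space \<nu>"
    and ae: "AE x in \<nu>. x \<in> {-1..1}"
    using \<nu> by (auto simp: prob_measure_on_def)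
  have [simp]: "space \<nu> = UNIV"
    using sets_eq_imp_space_eq[OF \<open>sets \<nu> = sets borel\<close>] by simp
  have [measurable]: "cnj \<in> borel_measurable borel"
    by (intro borel_measurable_continuous_onI continuous_intros)
  have half: "(a + a) / 2 = a" for a :: ennreal
    using mult_divide_eq_ennreal[of 2 a] top_neq_numeral[of "num.Bit0 num.One"]
    by (simp add: mult_2_right eq_commute)
  have em: "emeasure (szego \<nu>) A =
     (emeasure \<nu> {x. cis (arccos x) \<in> A} + emeasure \<nu> {x. cis (- arccos x) \<in> A}) / 2"
    if "A \<in> sets borel" for A
    using that by (simp add: emeasure_szego emeasure_distr vimage_def)
  have Sz1: "prob_measure_on (sphere 0 1) (szego \<nu>)"
  proof -
    have "emeasure (szego \<nu>) UNIV = 1"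
      using prob_space.emeasure_space_1[OF ps] half[of 1] by (simp add: em)
    then have "prob_space (szego \<nu>)"
      by (intro prob_spaceI) simp
    moreover have "AE w in szego \<nu>. w \<in> sphere 0 1"
    proof (rule AE_I)
      show "emeasure (szego \<nu>) (- sphere 0 1) = 0"
        by (subst em) (auto intro!: borel_comp)
    qed (auto intro!: borel_comp)
    ultimately show ?thesis
      by (simp add: prob_measure_on_def)
  qed
  have Sz2: "distr (szego \<nu>) borel cnj = szego \<nu>"
  proof (rule measure_eqI)
    fix A assume "A \<in> sets (distr (szego \<nu>) borel cnj)"
    then have A [measurable]: "A \<in> sets borel" by simp
    have [measurable]: "cnj -` A \<in> sets borel"
      using measurable_sets[of cnj borel borel A] by simp
    show "emeasure (distr (szego \<nu>) borel cnj) A = emeasure (szego \<nu>) A"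
      by (simp add: emeasure_distr em cis_cnj add.commute)
  qed simp
  have Sz3: "distr (szego \<nu>) borel Re = \<nu>"
  proof (rule measure_eqI)
    fix A assume "A \<in> sets (distr (szego \<nu>) borel Re)"
    then have A [measurable]: "A \<in> sets borel" by simp
    have [measurable]: "Re -` A \<in> sets borel"
      using measurable_sets[of Re borel borel A] by simp
    have "emeasure \<nu> {x. cos (arccos x) \<in> A} = emeasure \<nu> A"
    proof (rule emeasure_eq_AE)
      show "AE x in \<nu>. x \<in> {x. cos (arccos x) \<in> A} \<longleftrightarrow> x \<in> A"
        using ae by eventually_elim auto
    qed auto
    then show "emeasure (distr (szego \<nu>) borel Re) A = emeasure \<nu> A"
      by (simp add: emeasure_distr em half)
  qed simp
  have uniq: "emeasure \<sigma> A = emeasure (szego \<nu>) A"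
    if \<sigma>: "prob_measure_on (sphere 0 1) \<sigma>" "distr \<sigma> borel cnj = \<sigma>" "distr \<sigma> borel Re = \<nu>"
      and A [measurable]: "A \<in> sets borel" for \<sigma> :: "complex measure" and A
  proof -
    have [measurable_cong, simp]: "sets \<sigma> = sets borel" and ae': "AE w in \<sigma>. w \<in> sphere 0 1"
      using \<sigma> by (auto simp: prob_measure_on_def)
    have [simp]: "space \<sigma> = UNIV"
      using sets_eq_imp_space_eq[OF \<open>sets \<sigma> = sets borel\<close>] by simp
    have up: "emeasure \<nu> {x. cis (s * arccos x) \<in> A} = emeasure \<sigma> {w. cis (s * arccos (Re w)) \<in> A}" for s
      by (subst \<sigma>(3)[symmetric], subst emeasure_distr) (auto simp: vimage_def)
    have cnjA: "emeasure \<sigma> {w. cnj w \<in> A} = emeasure \<sigma> A"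
      by (subst (2) \<sigma>(2)[symmetric], subst emeasure_distr) (auto simp: vimage_def)
    have pt: "(cis (arccos (Re w)) = w \<and> cis (- arccos (Re w)) = cnj w) \<or>
              (cis (arccos (Re w)) = cnj w \<and> cis (- arccos (Re w)) = w)"
      if "w \<in> sphere 0 1" for w
    proof -
      from that have n: "cmod w = 1" by simp
      then have r: "\<bar>Re w\<bar> \<le> 1" using abs_Re_le_cmod[of w] by simp
      have "(Im w)\<^sup>2 = 1 - (Re w)\<^sup>2" using n cmod_power2[of w] by simp
      then have "sin (arccos (Re w)) = \<bar>Im w\<bar>"
        using r by (simp add: sin_arccos_abs flip: real_sqrt_abs)
      then show ?thesis
        using r by (auto simp: complex_eq_iff cos_arccos_abs abs_if split: if_splits)
    qed
    have nni: "(\<integral>\<^sup>+w. indicator A (f w) \<partial>\<sigma>) = emeasure \<sigma> {w. f w \<in> A}"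
      if [measurable]: "f \<in> borel_measurable borel" for f :: "complex \<Rightarrow> complex"
    proof -
      have "(\<integral>\<^sup>+w. indicator A (f w) \<partial>\<sigma>) = (\<integral>\<^sup>+w. indicator {w. f w \<in> A} w \<partial>\<sigma>)"
        by (rule nn_integral_cong) (simp add: indicator_def)
      also have "\<dots> = emeasure \<sigma> {w. f w \<in> A}"
        by (rule nn_integral_indicator) measurable
      finally show ?thesis .
    qed
    have "emeasure \<sigma> {w. cis (arccos (Re w)) \<in> A} + emeasure \<sigma> {w. cis (- arccos (Re w)) \<in> A}
        = (\<integral>\<^sup>+w. indicator A (cis (arccos (Re w))) + indicator A (cis (- arccos (Re w))) \<partial>\<sigma>)"
      by (subst nn_integral_add) (simp_all add: nni)
    also have "\<dots> = (\<integral>\<^sup>+w. indicator A w + indicator A (cnj w) \<partial>\<sigma>)"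
    proof (rule nn_integral_cong_AE)
      show "AE w in \<sigma>. (indicator A (cis (arccos (Re w))) + indicator A (cis (- arccos (Re w))) :: ennreal)
          = indicator A w + indicator A (cnj w)"
        using ae'
      proof eventually_elim
        case (elim w)
        then show ?case using pt[of w] by (auto simp: add.commute)
      qed
    qed
    also have "\<dots> = emeasure \<sigma> A + emeasure \<sigma> {w. cnj w \<in> A}"
      using nni[of "\<lambda>w. w"] by (subst nn_integral_add) (simp_all add: nni)
    finally show ?thesis
      using up[of 1] up[of "-1"] by (simp add: em cnjA half)
  qed
  show ?thesis
    using Sz1 Sz2 Sz3 uniq by (auto simp: prob_measure_on_def intro!: measure_eqI)
qed

definition C_function :: "complex measure \<Rightarrow> complex \<Rightarrow> complex" where
  "C_function \<sigma> z = (\<integral>w. (w + z) / (w - z) \<partial>\<sigma>)"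

definition monic_OPs :: "real measure \<Rightarrow> (nat \<Rightarrow> real poly) \<Rightarrow> bool" where
  "monic_OPs \<nu> p \<longleftrightarrow> (\<forall>n. degree (p n) = n \<and> lead_coeff (p n) = 1) \<and>
     (\<forall>m n. m \<noteq> n \<longrightarrow> (\<integral>x. poly (p m) x * poly (p n) x \<partial>\<nu>) = 0)"

text \<open>The polynomials \<open>P\<^sup>(\<^sup>k\<^sup>)\<^sub>n\<close> generated by the recurrence coefficients \<open>b\<close>, \<open>d\<close>.
  The degree index is an integer because \<open>P\<^sub>-\<^sub>1 = 0\<close> is used (the recurrence itself is
  \<open>assoc_poly_rec\<close>). The case \<open>k = 0\<close> gives the original polynomials \<open>P\<^sub>n\<close>.\<close>

fun assoc_poly_nat :: "(nat \<Rightarrow> real) \<Rightarrow> (nat \<Rightarrow> real) \<Rightarrow> nat \<Rightarrow> nat \<Rightarrow> real poly" where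
  "assoc_poly_nat b d k 0 = 1"
| "assoc_poly_nat b d k (Suc 0) = [:- b (k + 1), 1:]"
| "assoc_poly_nat b d k (Suc (Suc n)) =
     [:- b (n + 1 + k + 1), 1:] * assoc_poly_nat b d k (Suc n)
     - smult (d (n + 1 + k)) (assoc_poly_nat b d k n)"

definition assoc_poly :: "(nat \<Rightarrow> real) \<Rightarrow> (nat \<Rightarrow> real) \<Rightarrow> nat \<Rightarrow> int \<Rightarrow> real poly" where
  "assoc_poly b d k n = (if n < 0 then 0 else assoc_poly_nat b d k (nat n))"

lemma assoc_poly_minus_one: "assoc_poly b d k (- 1) = 0"
  and assoc_poly_0: "assoc_poly b d k 0 = 1"
  by (simp_all add: assoc_poly_def)

lemma assoc_poly_rec:
  "assoc_poly b d k (int n + 1) =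
     [:- b (n + k + 1), 1:] * assoc_poly b d k (int n) - smult (d (n + k)) (assoc_poly b d k (int n - 1))"
  by (cases n) (simp_all add: assoc_poly_def nat_add_distrib)

definition cpoly :: "real poly \<Rightarrow> complex \<Rightarrow> complex" where
  "cpoly p x = poly (map_poly complex_of_real p) x"

definition transfer_matrix :: "(nat \<Rightarrow> real) \<Rightarrow> (nat \<Rightarrow> real) \<Rightarrow> nat \<Rightarrow> complex \<Rightarrow> complex^2^2" where
  "transfer_matrix b d k x = vector
     [vector [cpoly (assoc_poly b d 0 (int k)) x,
              - cpoly (assoc_poly b d 1 (int k - 1)) x],
      vector [complex_of_real (d k) * cpoly (assoc_poly b d 0 (int k - 1)) x,
              - (complex_of_real (d k) * cpoly (assoc_poly b d 1 (int k - 2)) x)]]"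

text \<open>The relation \<open>f = (a g + b) / (c g + d)\<close> between values of functions. The denominator is
  required to be nonzero, so that the convention \<open>x / 0 = 0\<close> plays no role.\<close>

definition homography_eq :: "complex \<Rightarrow> complex^2^2 \<Rightarrow> complex \<Rightarrow> bool" where
  "homography_eq f M g \<longleftrightarrow>
     M $ 2 $ 1 * g + M $ 2 $ 2 \<noteq> 0 \<and>
     f = (M $ 1 $ 1 * g + M $ 1 $ 2) / (M $ 2 $ 1 * g + M $ 2 $ 2)"

end

theory Submission
  imports Defs
begin

text \<open>Let \<open>Q\<^sub>n(x) = \<integral> P\<^sub>n(t) / (x - t) d\<mu>(t)\<close> be the functions of the second kind. Then
  \<open>Q\<^sub>n = P\<^sub>n S - P\<^sup>(\<^sup>1\<^sup>)\<^sub>n\<^sub>-\<^sub>1\<close>, where \<open>S = Q\<^sub>0\<close> is the Stieltjes function, and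
  symmetrising the \<open>\<C>\<close>-function of the Szego transform under conjugation gives
  \<open>2z/(1-z\<^sup>2) F(z) = S(x)\<close>. It remains to see that \<open>Q\<^sub>k = d\<^sub>k Q\<^sub>k\<^sub>-\<^sub>1 S\<^sub>k\<close>. Both \<open>Q\<^sub>n\<^sub>+\<^sub>k\<close> and the second kind
  functions of \<open>\<mu>\<^sup>(\<^sup>k\<^sup>)\<close> solve the same three-term recurrence, so their Casoratian is its initial value
  \<open>Q\<^sub>k - d\<^sub>k Q\<^sub>k\<^sub>-\<^sub>1 S\<^sub>k\<close> times \<open>d\<^sub>k\<^sub>+\<^sub>1 \<cdots> d\<^sub>k\<^sub>+\<^sub>n\<close>. By Bessel's inequality both solutions are small
  compared with the norms of the orthogonal polynomials, and
  \<open>d\<^sub>n \<le> 1\<close> because the support lies in \<open>[-1,1]\<close>, which forces this initial value to vanish. The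
  denominator \<open>d\<^sub>k Q\<^sub>k\<^sub>-\<^sub>1\<close> is nonzero: otherwise \<open>Q\<^sub>k\<close> would vanish too, and running the recurrence
  backwards would give \<open>Q\<^sub>0 = Q\<^sub>1 = 0\<close>, contradicting \<open>Q\<^sub>1 = (x - b\<^sub>1) Q\<^sub>0 - 1\<close>.\<close>

section \<open>Integrability on a compact carrier and Bessel's inequality\<close>

text \<open>Intended for kernels with poles off \<open>S\<close>: continuity on the compact
  \<open>S\<close> bounds \<open>f\<close> almost everywhere, and Borel measurability is all that is
  asked elsewhere.\<close>

lemma integrable_continuous_on_AE:
  fixes f :: "'a::t2_space \<Rightarrow> 'b::{banach, second_countable_topology}"
  assumes "prob_measure_on S \<nu>" and "compact S"
    and "continuous_on S f" and [measurable]: "f \<in> borel_measurable borel"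
  shows "integrable \<nu> f"
proof -
  have [measurable_cong]: "sets \<nu> = sets borel" and ae: "AE x in \<nu>. x \<in> S"
    and "prob_space \<nu>"
    using assms(1) by (auto simp: prob_measure_on_def)
  interpret prob_space \<nu> by fact
  obtain B where B: "\<And>x. x \<in> S \<Longrightarrow> norm (f x) \<le> B"
    using compact_imp_bounded[OF compact_continuous_image[OF assms(3,2)]]
    by (auto simp: bounded_iff)
  show ?thesis
  proof (rule integrable_const_bound)
    show "AE x in \<nu>. norm (f x) \<le> B"
      using ae by eventually_elim (rule B)
  qed measurable
qed

text \<open>The residual of \<open>u\<close> after removing its first \<open>N\<close> Fourier terms
  has nonnegative squared norm, so the squared normalised coefficients are summable. The system
  \<open>e\<close> is orthogonal but not normalised, hence the quotient.\<close>

lemma bessel_tendsto_0: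
  fixes u :: "'a \<Rightarrow> real" and e :: "nat \<Rightarrow> 'a \<Rightarrow> real"
  assumes uu: "integrable M (\<lambda>t. u t * u t)"
    and ue: "\<And>n. integrable M (\<lambda>t. u t * e n t)"
    and ee: "\<And>m n. integrable M (\<lambda>t. e m t * e n t)"
    and orth: "\<And>m n. m \<noteq> n \<Longrightarrow> (\<integral>t. e m t * e n t \<partial>M) = 0"
    and pos: "\<And>n. (\<integral>t. e n t * e n t \<partial>M) > 0"
  shows "(\<lambda>n. (\<integral>t. u t * e n t \<partial>M)\<^sup>2 / (\<integral>t. e n t * e n t \<partial>M)) \<longlonglongrightarrow> 0"
proof -
  define c h where "c n = (\<integral>t. u t * e n t \<partial>M)" and "h n = (\<integral>t. e n t * e n t \<partial>M)" for n
  define a where "a n = c n / h n" for n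
  have h0: "h n > 0" for n
    using pos by (simp add: h_def)
  define r where "r N t = u t - (\<Sum>n<N. a n * e n t)" for N t
  have rSuc: "r (Suc N) t = r N t - a N * e N t" for N t
    by (simp add: r_def)
  have re: "integrable M (\<lambda>t. r N t * e n t)" for N n
    unfolding r_def left_diff_distrib sum_distrib_right mult.assoc
    by (intro Bochner_Integration.integrable_diff ue Bochner_Integration.integrable_sum
        integrable_mult_right ee)
  \<comment> \<open>The terms removed so far are orthogonal to \<open>e n\<close>; the case
    \<open>n = N\<close> feeds the Pythagoras step below.\<close>
  have re_eq: "(\<integral>t. r N t * e n t \<partial>M) = c n" if "N \<le> n" for N n
    using that
  proof (induction N)
    case 0
    then show ?case by (simp add: r_def c_def)
  next
    case (Suc N)
    have "(\<integral>t. r (Suc N) t * e n t \<partial>M) = (\<integral>t. r N t * e n t - a N * (e N t * e n t) \<partial>M)"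
      by (simp add: rSuc algebra_simps)
    also have "\<dots> = (\<integral>t. r N t * e n t \<partial>M) - a N * (\<integral>t. e N t * e n t \<partial>M)"
      by (subst Bochner_Integration.integral_diff) (auto intro!: re ee)
    finally show ?case
      using Suc orth[of N n] by simp
  qed
  have "integrable M (\<lambda>t. r N t * r N t) \<and>
    (\<integral>t. r N t * r N t \<partial>M) = (\<integral>t. u t * u t \<partial>M) - (\<Sum>n<N. (c n)\<^sup>2 / h n)" for N
  proof (induction N)
    case 0
    then show ?case using uu by (simp add: r_def)
  next
    case (Suc N)
    have eq: "r (Suc N) t * r (Suc N) t
        = r N t * r N t - (2 * a N) * (r N t * e N t) + (a N)\<^sup>2 * (e N t * e N t)" for t
      by (simp add: rSuc algebra_simps power2_eq_square)
    have "(\<integral>t. r (Suc N) t * r (Suc N) t \<partial>M)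
        = (\<integral>t. r N t * r N t \<partial>M) - 2 * a N * c N + (a N)\<^sup>2 * h N"
      unfolding eq using Suc re ee
      by (simp add: re_eq h_def)
    moreover have "- 2 * a N * c N + (a N)\<^sup>2 * h N = - ((c N)\<^sup>2 / h N)"
      using h0[of N] by (simp add: a_def field_simps power2_eq_square)
    moreover have "integrable M (\<lambda>t. r (Suc N) t * r (Suc N) t)"
      unfolding eq using Suc re ee
      by (intro Bochner_Integration.integrable_add Bochner_Integration.integrable_diff
          integrable_mult_right) auto
    ultimately show ?case using Suc by simp
  qed
  moreover have "0 \<le> (\<integral>t. r N t * r N t \<partial>M)" for N
    by (rule integral_nonneg_AE) simp
  ultimately have "(\<Sum>n<N. (c n)\<^sup>2 / h n) \<le> (\<integral>t. u t * u t \<partial>M)" for N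
    by (metis diff_ge_0_iff_ge)
  then have "summable (\<lambda>n. (c n)\<^sup>2 / h n)"
    using h0 by (intro summableI_nonneg_bounded[where x = "\<integral>t. u t * u t \<partial>M"]) (auto simp: less_imp_le)
  then show ?thesis
    unfolding c_def h_def by (rule summable_LIMSEQ_zero)
qed

section \<open>Evaluating the real polynomials at complex points\<close>

lemma map_poly_of_real_add: "map_poly of_real (p + q) = map_poly of_real p + map_poly of_real q"
  by (rule poly_eqI) (simp add: coeff_map_poly)

lemma map_poly_of_real_diff: "map_poly of_real (p - q) = map_poly of_real p - map_poly of_real q"
  by (rule poly_eqI) (simp add: coeff_map_poly)

lemma map_poly_of_real_smult: "map_poly of_real (smult c p) = smult (of_real c) (map_poly of_real p)"
  by (rule poly_eqI) (simp add: coeff_map_poly)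

lemma cpoly_0 [simp]: "cpoly 0 x = 0" and cpoly_1 [simp]: "cpoly 1 x = 1"
  by (simp_all add: cpoly_def)

lemma cpoly_assoc_poly_rec:
  "cpoly (assoc_poly b d k (int n + 1)) x =
     (x - of_real (b (n + k + 1))) * cpoly (assoc_poly b d k (int n)) x
     - of_real (d (n + k)) * cpoly (assoc_poly b d k (int n - 1)) x"
  unfolding assoc_poly_rec cpoly_def
  by (simp add: map_poly_of_real_add map_poly_of_real_diff map_poly_of_real_smult
      map_poly_pCons algebra_simps)

lemma poly_assoc_poly_rec:
  "poly (assoc_poly b d k (int n + 1)) t =
     (t - b (n + k + 1)) * poly (assoc_poly b d k (int n)) t
     - d (n + k) * poly (assoc_poly b d k (int n - 1)) t"
  unfolding assoc_poly_rec by (simp add: algebra_simps)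

section \<open>Norms and recurrence coefficients of the orthogonal polynomials\<close>

text \<open>Serves both measures of the theorem: \<open>\<mu>\<close> with shift 0 and
  \<open>\<mu>k\<close> with shift \<open>k\<close>.\<close>

locale assoc_OPs =
  fixes \<nu> :: "real measure" and b d :: "nat \<Rightarrow> real" and k :: nat
  assumes prob: "prob_measure_on {-1..1} \<nu>"
    and d_pos: "\<And>n. n \<ge> 1 \<Longrightarrow> d n > 0"
    and ops: "monic_OPs \<nu> (\<lambda>n. assoc_poly b d k (int n))"
begin

abbreviation p :: "nat \<Rightarrow> real \<Rightarrow> real" where
  "p n \<equiv> poly (assoc_poly b d k (int n))"

definition sqnorm :: "nat \<Rightarrow> real" where
  "sqnorm n = (\<integral>t. p n t * p n t \<partial>\<nu>)"

lemma prob_space: "prob_space \<nu>" and AE_Icc: "AE t in \<nu>. t \<in> {-1..1}"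
  and sets_eq [measurable_cong]: "sets \<nu> = sets borel"
  using prob by (auto simp: prob_measure_on_def)

lemma integrable_Icc:
  fixes f :: "real \<Rightarrow> 'b::{banach, second_countable_topology}"
  assumes "continuous_on {-1..1} f" "f \<in> borel_measurable borel"
  shows "integrable \<nu> f"
  using integrable_continuous_on_AE[OF prob _ assms] by simp

lemma integrable_continuous:
  fixes f :: "real \<Rightarrow> 'b::{banach, second_countable_topology}"
  assumes "continuous_on UNIV f"
  shows "integrable \<nu> f"
  using assms by (intro integrable_Icc borel_measurable_continuous_onI) (auto intro: continuous_on_subset)

lemma orth: "m \<noteq> n \<Longrightarrow> (\<integral>t. p m t * p n t \<partial>\<nu>) = 0"
  using ops by (auto simp: monic_OPs_def)

lemma orth_pred: "(\<integral>t. p (Suc n) t * poly (assoc_poly b d k (int n - 1)) t \<partial>\<nu>) = 0"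
proof (cases n)
  case (Suc m)
  then show ?thesis using orth[of "Suc n" m] by simp
qed (simp add: assoc_poly_minus_one)

lemma integral_p: "(\<integral>t. p n t \<partial>\<nu>) = (if n = 0 then 1 else 0)"
  using orth[of n 0] prob_space.prob_space[OF prob_space] by (auto simp: assoc_poly_0)

lemma mult_p:
  "t * p n t = p (Suc n) t + (b (n + k + 1) * p n t + d (n + k) * poly (assoc_poly b d k (int n - 1)) t)"
  using poly_assoc_poly_rec[of b d k n t] by (simp add: algebra_simps)

lemma sqnorm_0 [simp]: "sqnorm 0 = 1"
  using prob_space.prob_space[OF prob_space] by (simp add: sqnorm_def assoc_poly_0)

text \<open>The integral of \<open>t * p n t * p (Suc n) t\<close> is computed twice, attaching
  \<open>t\<close> first to \<open>p n\<close> and then to \<open>p (Suc n)\<close>, and expanding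
  by the recurrence.\<close>

lemma sqnorm_Suc: "sqnorm (Suc n) = d (Suc n + k) * sqnorm n"
proof -
  let ?p' = "poly (assoc_poly b d k (int n - 1))"
  have int: "integrable \<nu> (\<lambda>t. c * (poly q t * poly r t))" for c q r
    by (intro integrable_continuous continuous_intros)
  have "sqnorm (Suc n) = (\<integral>t. p (Suc n) t * (t * p n t) \<partial>\<nu>)"
  proof -
    \<comment> \<open>The factor \<open>1 *\<close> gives every summand the shape covered by
      \<open>int\<close>.\<close>
    have eq: "p (Suc n) t * (t * p n t) = 1 * (p (Suc n) t * p (Suc n) t)
        + (b (n + k + 1) * (p (Suc n) t * p n t) + d (n + k) * (p (Suc n) t * ?p' t))" for t
      unfolding mult_p by (simp add: algebra_simps)
    show ?thesis
      unfolding eq using orth[of "Suc n" n] orth_pred[of n]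
      by (subst Bochner_Integration.integral_add, (intro int Bochner_Integration.integrable_add)+)+
         (simp add: sqnorm_def)
  qed
  also have "\<dots> = (\<integral>t. p n t * (t * p (Suc n) t) \<partial>\<nu>)"
    by (simp add: algebra_simps)
  also have "\<dots> = d (Suc n + k) * sqnorm n"
  proof -
    have eq: "p n t * (t * p (Suc n) t) = 1 * (p n t * p (Suc (Suc n)) t)
        + (b (Suc n + k + 1) * (p n t * p (Suc n) t) + d (Suc n + k) * (p n t * p n t))" for t
      unfolding mult_p by (simp add: algebra_simps)
    show ?thesis
      unfolding eq using orth[of n "Suc n"] orth[of n "Suc (Suc n)"]
      by (subst Bochner_Integration.integral_add, (intro int Bochner_Integration.integrable_add)+)+
         (simp add: sqnorm_def)
  qed
  finally show ?thesis .
qed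

lemma sqnorm_pos: "sqnorm n > 0"
  by (induction n) (auto simp: sqnorm_Suc d_pos)

text \<open>By the recurrence, \<open>t * p n t\<close> is \<open>p (Suc n) t\<close> plus an
  orthogonal remainder \<open>?q\<close>, so Pythagoras bounds \<open>sqnorm (Suc n)\<close> by the
  squared norm of \<open>t * p n t\<close>; then \<open>t\<^sup>2 \<le> 1\<close> almost
  everywhere.\<close>

lemma sqnorm_mono: "sqnorm (Suc n) \<le> sqnorm n"
proof -
  let ?q = "\<lambda>t. b (n + k + 1) * p n t + d (n + k) * poly (assoc_poly b d k (int n - 1)) t"
  have cross: "(\<integral>t. p (Suc n) t * ?q t \<partial>\<nu>) = 0"
  proof -
    have int: "integrable \<nu> (\<lambda>t. c * (poly q t * poly r t))" for c q r
      by (intro integrable_continuous continuous_intros)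
    have "(\<integral>t. p (Suc n) t * ?q t \<partial>\<nu>) = (\<integral>t. b (n + k + 1) * (p (Suc n) t * p n t)
        + d (n + k) * (p (Suc n) t * poly (assoc_poly b d k (int n - 1)) t) \<partial>\<nu>)"
      by (simp add: algebra_simps)
    also have "\<dots> = 0"
      using orth[of "Suc n" n] orth_pred[of n]
      by (subst Bochner_Integration.integral_add, (intro int)+) simp
    finally show ?thesis .
  qed
  have "sqnorm (Suc n) \<le> sqnorm (Suc n) + 2 * (\<integral>t. p (Suc n) t * ?q t \<partial>\<nu>) + (\<integral>t. (?q t)\<^sup>2 \<partial>\<nu>)"
    unfolding cross by simp
  also have "\<dots> = (\<integral>t. p (Suc n) t * p (Suc n) t + 2 * (p (Suc n) t * ?q t) + (?q t)\<^sup>2 \<partial>\<nu>)"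
    unfolding sqnorm_def
    by (subst Bochner_Integration.integral_add,
        (intro integrable_continuous continuous_intros)+)+ simp
  also have "\<dots> = (\<integral>t. (t * p n t)\<^sup>2 \<partial>\<nu>)"
    unfolding mult_p by (simp add: power2_eq_square algebra_simps)
  also have "\<dots> \<le> sqnorm n"
    unfolding sqnorm_def
  proof (rule integral_mono_AE)
    show "AE t in \<nu>. (t * p n t)\<^sup>2 \<le> p n t * p n t"
      using AE_Icc
    proof eventually_elim
      case (elim t)
      then have "t\<^sup>2 \<le> 1" by (simp add: abs_square_le_1 abs_le_iff)
      then show ?case
        using mult_right_mono[of "t\<^sup>2" 1 "(p n t)\<^sup>2"] by (simp add: power2_eq_square mult_ac)
    qed
  qed (intro integrable_continuous continuous_intros)+
  finally show ?thesis .
qed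

lemma d_le_1: "d (Suc n + k) \<le> 1"
  using sqnorm_mono[of n] sqnorm_pos[of n] by (simp add: sqnorm_Suc)

section \<open>Functions of the second kind\<close>

definition Q :: "complex \<Rightarrow> nat \<Rightarrow> complex" where
  "Q x n = (\<integral>t. of_real (p n t) / (x - of_real t) \<partial>\<nu>)"

context
  fixes x :: complex
  assumes x: "x \<notin> of_real ` {-1..1}"
begin

lemma integrable_Stieltjes: "integrable \<nu> (\<lambda>t. of_real (poly q t) / (x - of_real t))"
proof (rule integrable_Icc)
  have "x - of_real t \<noteq> 0" if "t \<in> {-1..1}" for t
    using x that by auto
  then show "continuous_on {-1..1} (\<lambda>t. of_real (poly q t) / (x - of_real t))"
    by (intro continuous_intros) auto
  have [measurable]: "poly q \<in> borel_measurable borel"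
    by (intro borel_measurable_continuous_onI continuous_intros)
  show "(\<lambda>t. of_real (poly q t) / (x - of_real t)) \<in> borel_measurable borel"
    by measurable
qed

text \<open>Writing \<open>t = x - (x - t)\<close> in the recurrence cancels one denominator and
  leaves the integral of \<open>p n\<close>, which is 1 for \<open>n = 0\<close> and 0 otherwise.
  The last integral is spelled out because its degree index is -1 when \<open>n = 0\<close>.\<close>

lemma Q_Suc:
  "Q x (Suc n) = (x - of_real (b (n + k + 1))) * Q x n
     - of_real (d (n + k)) * (\<integral>t. of_real (poly (assoc_poly b d k (int n - 1)) t) / (x - of_real t) \<partial>\<nu>)
     - (if n = 0 then 1 else 0)"
proof -
  let ?p' = "poly (assoc_poly b d k (int n - 1))"
  have "Q x (Suc n) = (\<integral>t. (x - of_real (b (n + k + 1))) * (of_real (p n t) / (x - of_real t))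
      - of_real (d (n + k)) * (of_real (?p' t) / (x - of_real t)) - of_real (p n t) \<partial>\<nu>)"
    unfolding Q_def
  proof (rule integral_cong_AE)
    have [measurable]: "poly q \<in> borel_measurable borel" for q :: "real poly"
      by (intro borel_measurable_continuous_onI continuous_intros)
    show "(\<lambda>t. of_real (p (Suc n) t) / (x - of_real t)) \<in> borel_measurable \<nu>"
      and "(\<lambda>t. (x - of_real (b (n + k + 1))) * (of_real (p n t) / (x - of_real t))
      - of_real (d (n + k)) * (of_real (?p' t) / (x - of_real t)) - of_real (p n t)) \<in> borel_measurable \<nu>"
      by measurable
    show "AE t in \<nu>. of_real (p (Suc n) t) / (x - of_real t) =
        (x - of_real (b (n + k + 1))) * (of_real (p n t) / (x - of_real t))
      - of_real (d (n + k)) * (of_real (?p' t) / (x - of_real t)) - of_real (p n t)"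
      using AE_Icc
    proof eventually_elim
      case (elim t)
      then have nz: "x - of_real t \<noteq> 0" using x by auto
      have p_Suc: "p (Suc n) t = (t - b (n + k + 1)) * p n t - d (n + k) * ?p' t"
        using poly_assoc_poly_rec[of b d k n t] by (simp add: add.commute)
      have "complex_of_real (p (Suc n) t) = (x - of_real (b (n + k + 1))) * of_real (p n t)
          - of_real (d (n + k)) * of_real (?p' t) - of_real (p n t) * (x - of_real t)"
        unfolding p_Suc of_real_diff of_real_mult by (simp add: algebra_simps)
      then show ?case
        using nz by (simp add: diff_divide_distrib)
    qed
  qed
  also have "\<dots> = (x - of_real (b (n + k + 1))) * Q x n
     - of_real (d (n + k)) * (\<integral>t. of_real (?p' t) / (x - of_real t) \<partial>\<nu>) - of_real (\<integral>t. p n t \<partial>\<nu>)"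
  proof -
    have "integrable \<nu> (\<lambda>t. complex_of_real (p n t))"
      by (intro integrable_continuous continuous_intros)
    then show ?thesis
      unfolding Q_def
      by (subst Bochner_Integration.integral_diff,
          (intro Bochner_Integration.integrable_diff integrable_mult_right integrable_Stieltjes | assumption)+)+
         (simp only: integral_mult_right_zero integral_complex_of_real)
  qed
  finally show ?thesis by (simp add: integral_p)
qed

lemma Q_1: "Q x (Suc 0) = (x - of_real (b (k + 1))) * Q x 0 - 1"
  using Q_Suc[of 0] by (simp add: assoc_poly_minus_one)

lemma Q_Suc_Suc:
  "Q x (Suc (Suc n)) = (x - of_real (b (Suc n + k + 1))) * Q x (Suc n) - of_real (d (Suc n + k)) * Q x n"
  using Q_Suc[of "Suc n"] by (simp add: Q_def)

text \<open>Both sides obey the same recurrence and agree for \<open>n = 0\<close> and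
  \<open>n = 1\<close>; the constant 1 subtracted in \<open>Q_1\<close> is the associated polynomial
  of degree 0.\<close>

lemma Q_eq:
  "Q x n = cpoly (assoc_poly b d k (int n)) x * Q x 0 - cpoly (assoc_poly b d (Suc k) (int n - 1)) x"
proof (induction n rule: less_induct)
  case (less n)
  consider "n = 0" | "n = Suc 0" | m where "n = Suc (Suc m)"
    using nat.exhaust by metis
  then show ?case
  proof cases
    case 1
    then show ?thesis by (simp add: assoc_poly_minus_one assoc_poly_0)
  next
    case 2
    then show ?thesis
      using cpoly_assoc_poly_rec[of b d k 0 x]
      by (simp add: assoc_poly_minus_one assoc_poly_0 Q_1)
  next
    case (3 m)
    have P: "cpoly (assoc_poly b d k (int n)) x
        = (x - of_real (b (Suc m + k + 1))) * cpoly (assoc_poly b d k (int (Suc m))) x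
        - of_real (d (Suc m + k)) * cpoly (assoc_poly b d k (int m)) x"
      using cpoly_assoc_poly_rec[of b d k "Suc m" x] 3 by (simp add: add.commute)
    have P1: "cpoly (assoc_poly b d (Suc k) (int n - 1)) x
        = (x - of_real (b (Suc m + k + 1))) * cpoly (assoc_poly b d (Suc k) (int (Suc m) - 1)) x
        - of_real (d (Suc m + k)) * cpoly (assoc_poly b d (Suc k) (int m - 1)) x"
      using cpoly_assoc_poly_rec[of b d "Suc k" m x] 3 by (simp add: add.commute)
    have Q_n: "Q x n = (x - of_real (b (Suc m + k + 1))) * Q x (Suc m) - of_real (d (Suc m + k)) * Q x m"
      by (simp only: 3 Q_Suc_Suc)
    have "m < n" "Suc m < n"
      using 3 by simp_all
    note IH = this[THEN less]
    show ?thesis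
      unfolding Q_n P P1 IH by (simp add: algebra_simps)
  qed
qed

text \<open>These are the normalised Fourier coefficients of the kernel \<open>1 / (x - t)\<close>,
  so Bessel applies, to real and imaginary parts separately.\<close>

lemma Q_normalised_tendsto_0: "(\<lambda>n. Q x n / of_real (sqrt (sqnorm n))) \<longlonglongrightarrow> 0"
proof -
  have nz: "x - of_real t \<noteq> 0" if "t \<in> {-1..1}" for t
    using x that by auto
  \<comment> \<open>Used with \<open>u\<close> equal to \<open>Re\<close> and to
    \<open>Im\<close>.\<close>
  have *: "(\<lambda>n. (\<integral>t. u (1 / (x - of_real t)) * p n t \<partial>\<nu>) / sqrt (sqnorm n)) \<longlonglongrightarrow> 0"
    if u: "continuous_on UNIV u" for u :: "complex \<Rightarrow> real"
  proof -
    define v where "v t = u (1 / (x - of_real t))" for t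
    have v: "continuous_on {-1..1} v"
      unfolding v_def using nz by (intro continuous_on_compose2[OF u] continuous_intros) auto
    have [measurable]: "u \<in> borel_measurable borel" "poly q \<in> borel_measurable borel" for q :: "real poly"
      by (intro borel_measurable_continuous_onI continuous_intros u)+
    have [measurable]: "v \<in> borel_measurable borel"
      unfolding v_def by measurable
    have "(\<lambda>n. (\<integral>t. v t * p n t \<partial>\<nu>)\<^sup>2 / sqnorm n) \<longlonglongrightarrow> 0"
      unfolding sqnorm_def
    proof (rule bessel_tendsto_0)
      show "integrable \<nu> (\<lambda>t. v t * v t)" and "integrable \<nu> (\<lambda>t. v t * p n t)" for n
        by (intro integrable_Icc continuous_intros v; measurable)+
      show "integrable \<nu> (\<lambda>t. p m t * p n t)" for m n
        by (intro integrable_continuous continuous_intros)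
      show "(\<integral>t. p m t * p n t \<partial>\<nu>) = 0" if "m \<noteq> n" for m n
        using orth that .
      show "(\<integral>t. p n t * p n t \<partial>\<nu>) > 0" for n
        using sqnorm_pos by (simp add: sqnorm_def)
    qed
    moreover have "(\<integral>t. v t * p n t \<partial>\<nu>)\<^sup>2 / sqnorm n = ((\<integral>t. v t * p n t \<partial>\<nu>) / sqrt (sqnorm n))\<^sup>2" for n
      using sqnorm_pos[of n] by (simp add: power_divide)
    ultimately have "(\<lambda>n. \<bar>(\<integral>t. v t * p n t \<partial>\<nu>) / sqrt (sqnorm n)\<bar>) \<longlonglongrightarrow> 0"
      using tendsto_real_sqrt[of "\<lambda>n. ((\<integral>t. v t * p n t \<partial>\<nu>) / sqrt (sqnorm n))\<^sup>2" 0 sequentially]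
      by simp
    then show ?thesis
      unfolding v_def by (rule tendsto_rabs_zero_cancel)
  qed
  have Re: "Re (Q x n) = (\<integral>t. Re (1 / (x - of_real t)) * p n t \<partial>\<nu>)"
    and Im: "Im (Q x n) = (\<integral>t. Im (1 / (x - of_real t)) * p n t \<partial>\<nu>)" for n
  proof -
    have eq: "of_real c / y = (1 / y) * of_real c" "Re (y * of_real c) = Re y * c"
      "Im (y * of_real c) = Im y * c" for c and y :: complex
      by simp_all
    note int = integrable_Stieltjes[of "assoc_poly b d k (int n)"]
    show "Re (Q x n) = (\<integral>t. Re (1 / (x - of_real t)) * p n t \<partial>\<nu>)"
      unfolding Q_def integral_Re[OF int, symmetric] by (simp only: eq)
    show "Im (Q x n) = (\<integral>t. Im (1 / (x - of_real t)) * p n t \<partial>\<nu>)"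
      unfolding Q_def integral_Im[OF int, symmetric] by (simp only: eq)
  qed
  show ?thesis
    unfolding tendsto_complex_iff using *[of Re] *[of Im]
    by (simp add: Re Im continuous_on_Re continuous_on_Im Re_divide_of_real Im_divide_of_real del: of_real_sqrt)
qed

end

end

section \<open>From the unit circle to the interval\<close>

text \<open>Invariance under \<open>cnj\<close> allows adding the integrand at \<open>w\<close> and
  at \<open>cnj w\<close>. On the circle this sum depends on \<open>Re w\<close> alone, so the
  push-forward under \<open>Re\<close> turns it into an integral over \<open>\<mu>\<close>.\<close>

lemma C_function_szego:
  assumes \<mu>: "prob_measure_on {-1..1} \<mu>" and z: "0 < cmod z" "cmod z < 1"
  shows "2 * z / (1 - z\<^sup>2) * C_function (szego \<mu>) z
    = (\<integral>t. 1 / ((z + inverse z) / 2 - of_real t) \<partial>\<mu>)"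
proof -
  define \<sigma> where "\<sigma> = szego \<mu>"
  have \<sigma>: "prob_measure_on (sphere 0 1) \<sigma>" and cnj: "distr \<sigma> borel cnj = \<sigma>" and Re: "distr \<sigma> borel Re = \<mu>"
    using szego_iff[OF \<mu>, of \<sigma>] by (auto simp: \<sigma>_def)
  have [measurable_cong]: "sets \<sigma> = sets borel" and ae: "AE w in \<sigma>. w \<in> sphere 0 1"
    using \<sigma> by (auto simp: prob_measure_on_def)
  have [measurable]: "cnj \<in> borel_measurable borel"
    by (intro borel_measurable_continuous_onI continuous_intros)
  define f where "f w = (w + z) / (w - z)" for w
  have [measurable]: "f \<in> borel_measurable borel"
    unfolding f_def by measurable
  have f: "integrable \<sigma> f"
    by (rule integrable_continuous_on_AE[OF \<sigma>])
       (use z in \<open>auto simp: f_def intro!: continuous_intros\<close>)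
  have f_cnj: "integrable \<sigma> (\<lambda>w. f (cnj w))"
    using integrable_distr_eq[of cnj \<sigma> borel f] f cnj by simp
  have z0: "z \<noteq> 0" using z by auto
  have z1: "1 - z\<^sup>2 \<noteq> 0"
  proof
    assume "1 - z\<^sup>2 = 0"
    then have "cmod z ^ 2 = 1" by (simp flip: norm_power)
    then show False using z by (simp add: power2_eq_1_iff)
  qed
  have "2 * C_function \<sigma> z = (\<integral>w. f w \<partial>\<sigma>) + (\<integral>w. f w \<partial>distr \<sigma> borel cnj)"
    by (simp add: cnj C_function_def f_def)
  also have "\<dots> = (\<integral>w. f w + f (cnj w) \<partial>\<sigma>)"
    using f f_cnj by (simp add: integral_distr)
  also have "\<dots> = (\<integral>w. (1 - z\<^sup>2) / z * (1 / ((z + inverse z) / 2 - of_real (Re w))) \<partial>\<sigma>)"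
  proof (rule integral_cong_AE)
    show "AE w in \<sigma>. f w + f (cnj w) = (1 - z\<^sup>2) / z * (1 / ((z + inverse z) / 2 - of_real (Re w)))"
      using ae
    proof eventually_elim
      case (elim w)
      then have w: "w * cnj w = 1" "cmod w = 1" by (auto simp flip: complex_norm_square)
      have "w - z \<noteq> 0" "cnj w - z \<noteq> 0" using z w by (metis complex_mod_cnj eq_iff_diff_eq_0 less_irrefl)+
      moreover have "(w - z) * (cnj w - z) = 2 * z * ((z + inverse z) / 2 - of_real (Re w))"
      proof -
        have "(w - z) * (cnj w - z) = 1 - z * (w + cnj w) + z\<^sup>2"
          using w(1) by (simp add: algebra_simps power2_eq_square)
        then show ?thesis
          using z0 by (simp add: complex_add_cnj algebra_simps power2_eq_square)
      qed
      moreover have "(w + z) * (cnj w - z) + (cnj w + z) * (w - z) = 2 * (1 - z\<^sup>2)"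
        using w(1) by (simp add: algebra_simps power2_eq_square)
      ultimately have "f w + f (cnj w) = 2 * (1 - z\<^sup>2) / (2 * z * ((z + inverse z) / 2 - of_real (Re w)))"
        unfolding f_def by (metis add_frac_eq mult.commute)
      also have "\<dots> = (1 - z\<^sup>2) / (z * ((z + inverse z) / 2 - of_real (Re w)))"
        unfolding mult.assoc by (rule mult_divide_mult_cancel_left) simp
      finally show ?case by simp
    qed
  qed measurable
  also have "\<dots> = (1 - z\<^sup>2) / z * (\<integral>t. 1 / ((z + inverse z) / 2 - of_real t) \<partial>distr \<sigma> borel Re)"
    by (simp only: integral_mult_right_zero) (subst integral_distr; simp)
  finally have "2 * C_function \<sigma> z = (1 - z\<^sup>2) / z * (\<integral>t. 1 / ((z + inverse z) / 2 - of_real t) \<partial>\<mu>)"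
    unfolding Re .
  moreover have "2 * z / (1 - z\<^sup>2) * c = i" if "2 * c = (1 - z\<^sup>2) / z * i" for c i
  proof -
    have "2 * z / (1 - z\<^sup>2) * c = z / (1 - z\<^sup>2) * (2 * c)" by simp
    then show ?thesis unfolding that using z0 z1 by simp
  qed
  ultimately show ?thesis unfolding \<sigma>_def by blast
qed

text \<open>For a value \<open>t\<close> in [-1,1], \<open>z\<close> would be a root of
  \<open>z\<^sup>2 - 2 * t * z + 1\<close>, whose roots \<open>c\<close> and \<open>cnj c\<close>
  lie on the unit circle.\<close>

lemma joukowski_notin_Icc:
  assumes "0 < cmod z" "cmod z < 1"
  shows "(z + inverse z) / 2 \<notin> of_real ` {-1..1}"
proof
  assume "(z + inverse z) / 2 \<in> of_real ` {-1..1}"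
  then obtain t where t: "t \<in> {-1..1}" "(z + inverse z) / 2 = of_real t" by auto
  define c where "c = cis (arccos t)"
  have "Re c = t"
    using t by (simp add: c_def)
  then have c: "c + cnj c = 2 * of_real t" "c * cnj c = 1" "cmod c = 1" "cmod (cnj c) = 1"
    by (simp_all add: complex_add_cnj) (simp_all add: c_def cis_cnj cis_mult)
  have "z\<^sup>2 + 1 = 2 * of_real t * z"
    using t(2) assms by (auto simp: field_simps power2_eq_square)
  then have "(z - c) * (z - cnj c) = 0"
    unfolding c(1)[symmetric] using c(2) by (simp add: algebra_simps power2_eq_square)
  then show False
    using c(3,4) assms by auto
qed

section \<open>The Casoratian argument and the homography\<close>

theorem theorem2:
  fixes \<mu> \<mu>k :: "real measure" and \<sigma> \<sigma>k :: "complex measure"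
    and b d :: "nat \<Rightarrow> real" and k :: nat and F Fk :: "complex \<Rightarrow> complex"
  assumes "prob_measure_on {-1..1} \<mu>" and "nontrivial_measure \<mu>"
    and "\<forall>n\<ge>1. d n > 0"
    and "monic_OPs \<mu> (\<lambda>n. assoc_poly b d 0 (int n))"
    and "\<sigma> = szego \<mu>" and "F = C_function \<sigma>"
    and "k \<ge> 1"
    and "prob_measure_on {-1..1} \<mu>k"
    and "monic_OPs \<mu>k (\<lambda>n. assoc_poly b d k (int n))"
    and "\<sigma>k = szego \<mu>k" and "Fk = C_function \<sigma>k"
  shows "\<forall>z. 0 < cmod z \<and> cmod z < 1 \<longrightarrow>
    homography_eq (2 * z / (1 - z\<^sup>2) * Fk z)
      (transfer_matrix b d k ((z + inverse z) / 2))
      (2 * z / (1 - z\<^sup>2) * F z)"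
proof (intro allI impI)
  fix z :: complex
  assume z: "0 < cmod z \<and> cmod z < 1"
  define x where "x = (z + inverse z) / 2"
  have x: "x \<notin> of_real ` {-1..1}"
    unfolding x_def using z by (intro joukowski_notin_Icc) auto
  interpret A: assoc_OPs \<mu> b d 0
    using assms by unfold_locales auto
  interpret B: assoc_OPs \<mu>k b d k
    using assms by unfold_locales auto
  define Q R where "Q n = A.Q x n" and "R n = B.Q x n" for n
  obtain j where j: "k = Suc j"
    using \<open>k \<ge> 1\<close> by (cases k) auto
  have F: "2 * z / (1 - z\<^sup>2) * F z = Q 0"
    using C_function_szego[of \<mu> z] assms z by (simp add: Q_def A.Q_def x_def assoc_poly_0)
  have Fk: "2 * z / (1 - z\<^sup>2) * Fk z = R 0"
    using C_function_szego[of \<mu>k z] assms z by (simp add: R_def B.Q_def x_def assoc_poly_0)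
  have Q_rec: "Q (Suc (Suc n)) = (x - of_real (b (Suc n + 1))) * Q (Suc n) - of_real (d (Suc n)) * Q n" for n
    using A.Q_Suc_Suc[OF x, of n] by (simp add: Q_def)
  have R_rec: "R (Suc (Suc n)) = (x - of_real (b (Suc n + k + 1))) * R (Suc n) - of_real (d (Suc n + k)) * R n" for n
    using B.Q_Suc_Suc[OF x, of n] by (simp add: R_def)
  have R_1: "R (Suc 0) = (x - of_real (b (k + 1))) * R 0 - 1"
    using B.Q_1[OF x] by (simp add: R_def)

  have Q_Suc_k: "Q (Suc k) = (x - of_real (b (k + 1))) * Q k - of_real (d k) * Q j"
    using Q_rec[of j] by (simp add: j)
  define w where "w = Q k - of_real (d k) * Q j * R 0"
  \<comment> \<open>The product of the coefficients from index \<open>k + 1\<close> to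
    \<open>k + n\<close> is exactly \<open>B.sqnorm n\<close>.\<close>
  have W: "Q (Suc n + k) * R n - Q (n + k) * R (Suc n) = w * of_real (B.sqnorm n)" for n
  proof (induction n)
    case 0
    show ?case
      by (simp add: w_def Q_Suc_k R_1 algebra_simps)
  next
    case (Suc n)
    have "Q (Suc (Suc n) + k) * R (Suc n) - Q (Suc n + k) * R (Suc (Suc n))
        = of_real (d (Suc n + k)) * (Q (Suc n + k) * R n - Q (n + k) * R (Suc n))"
      unfolding Q_rec[of "n + k", folded add_Suc] R_rec[of n] by (simp add: algebra_simps)
    then show ?case
      unfolding Suc by (simp add: B.sqnorm_Suc)
  qed
  have sq: "A.sqnorm (n + k) = A.sqnorm k * B.sqnorm n" for n
    by (induction n) (simp_all add: A.sqnorm_Suc B.sqnorm_Suc)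
  define q r where "q n = Q n / of_real (sqrt (A.sqnorm n))" and "r n = R n / of_real (sqrt (B.sqnorm n))" for n
  have q: "q \<longlonglongrightarrow> 0" and r: "r \<longlonglongrightarrow> 0"
    unfolding q_def r_def Q_def R_def
    by (rule A.Q_normalised_tendsto_0[OF x] B.Q_normalised_tendsto_0[OF x])+
  \<comment> \<open>Normalising \<open>W\<close> by means of \<open>sq\<close> makes
    \<open>B.sqnorm n\<close> cancel; besides null sequences only a constant and a factor at most 1
    remain.\<close>
  have w_eq: "w = of_real (sqrt (A.sqnorm k)) * of_real (sqrt (d (Suc n + k))) * (q (Suc n + k) * r n - q (n + k) * r (Suc n))" for n
  proof -
    have pos: "A.sqnorm k > 0" "B.sqnorm n > 0" "d (Suc n + k) > 0"
      using A.sqnorm_pos B.sqnorm_pos assms by auto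
    define \<alpha> \<beta> \<delta> :: complex where "\<alpha> = of_real (sqrt (A.sqnorm k))" and "\<beta> = of_real (sqrt (B.sqnorm n))"
      and "\<delta> = of_real (sqrt (d (Suc n + k)))"
    have nz: "\<alpha> \<noteq> 0" "\<beta> \<noteq> 0" "\<delta> \<noteq> 0"
      using pos by (auto simp: \<alpha>_def \<beta>_def \<delta>_def)
    have "Q (Suc n + k) = q (Suc n + k) * (\<alpha> * \<beta> * \<delta>)" "Q (n + k) = q (n + k) * (\<alpha> * \<beta>)"
      "R n = r n * \<beta>" "R (Suc n) = r (Suc n) * (\<beta> * \<delta>)"
      unfolding q_def r_def \<alpha>_def \<beta>_def \<delta>_def using pos sq[of n] sq[of "Suc n"]
      by (simp_all add: real_sqrt_mult B.sqnorm_Suc)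
    moreover have "of_real (B.sqnorm n) = \<beta> * \<beta>"
      using pos by (simp add: \<beta>_def flip: of_real_mult)
    ultimately have "w * (\<beta> * \<beta>) = \<alpha> * \<delta> * (q (Suc n + k) * r n - q (n + k) * r (Suc n)) * (\<beta> * \<beta>)"
      using W[of n] by (simp add: algebra_simps)
    then show ?thesis
      using nz by (simp add: \<alpha>_def \<delta>_def)
  qed
  have "(\<lambda>n. of_real (sqrt (A.sqnorm k)) * (q (Suc n + k) * r n - q (n + k) * r (Suc n))) \<longlonglongrightarrow> of_real (sqrt (A.sqnorm k)) * (0 * 0 - 0 * 0)"
    using LIMSEQ_ignore_initial_segment[OF q, of "Suc k"] LIMSEQ_ignore_initial_segment[OF q, of k]
      LIMSEQ_Suc[OF r]
    by (intro tendsto_intros r) simp_all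
  then have lim: "(\<lambda>n. cmod (of_real (sqrt (A.sqnorm k)) * (q (Suc n + k) * r n - q (n + k) * r (Suc n)))) \<longlonglongrightarrow> 0"
    using tendsto_norm by fastforce
  \<comment> \<open>Here \<open>d_le_1\<close> removes the factor depending on \<open>d\<close>;
    since \<open>w\<close> is independent of \<open>n\<close>, it must vanish.\<close>
  have "cmod w \<le> cmod (of_real (sqrt (A.sqnorm k)) * (q (Suc n + k) * r n - q (n + k) * r (Suc n)))" for n
  proof -
    have "sqrt (d (Suc n + k)) \<le> 1"
      using B.d_le_1 by simp
    then show ?thesis
      using assms(3) unfolding w_eq[of n] norm_mult
      by (intro mult_right_mono) (auto simp: mult_left_le less_imp_le)
  qed
  then have "cmod w \<le> 0"
    by (intro LIMSEQ_le_const[OF lim]) auto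
  then have Qk: "Q k = of_real (d k) * Q j * R 0"
    by (simp add: w_def)

  have nonzero: "Q j \<noteq> 0"
  proof
    assume 0: "Q j = 0"
    \<comment> \<open>Downward induction from \<open>j\<close>: the base uses \<open>Qk\<close>, and
      each step solves the recurrence for \<open>Q m\<close> by dividing by
      \<open>d (Suc m) > 0\<close>.\<close>
    have "Q m = 0 \<and> Q (Suc m) = 0" if "m \<le> j" for m
      using that
    proof (induction rule: inc_induct)
      case base
      show ?case using 0 Qk j by simp
    next
      case (step m)
      moreover have "d (Suc m) > 0" using assms(3) by simp
      ultimately show ?case using Q_rec[of m] by auto
    qed
    then have "Q 0 = 0" "Q (Suc 0) = 0"
      by blast+
    moreover have "Q (Suc 0) = (x - of_real (b 1)) * Q 0 - 1"
      using A.Q_1[OF x] by (simp add: Q_def)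
    ultimately show False by simp
  qed
  have Q_eq: "Q n = cpoly (assoc_poly b d 0 (int n)) x * Q 0 - cpoly (assoc_poly b d 1 (int n - 1)) x" for n
    using A.Q_eq[OF x, of n] by (simp add: Q_def)
  have "d k \<noteq> 0"
    using assms(3,7) by force
  have num: "cpoly (assoc_poly b d 0 (int k)) x * Q 0 + - cpoly (assoc_poly b d 1 (int k - 1)) x = Q k"
    using Q_eq[of k] by simp
  \<comment> \<open>With \<open>k = Suc j\<close> the indices \<open>int k - 1\<close> and
    \<open>int k - 2\<close> are \<open>int j\<close> and \<open>int j - 1\<close>, as in
    \<open>Q_eq\<close> at \<open>j\<close>; for \<open>k = 1\<close> the latter is -1.\<close>
  have den: "of_real (d k) * cpoly (assoc_poly b d 0 (int k - 1)) x * Q 0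
      + - (of_real (d k) * cpoly (assoc_poly b d 1 (int k - 2)) x) = of_real (d k) * Q j"
    unfolding Q_eq[of j] by (simp add: j algebra_simps)
  show "homography_eq (2 * z / (1 - z\<^sup>2) * Fk z)
      (transfer_matrix b d k ((z + inverse z) / 2)) (2 * z / (1 - z\<^sup>2) * F z)"
    unfolding F Fk homography_eq_def transfer_matrix_def x_def[symmetric] vector_2 num den
    using nonzero \<open>d k \<noteq> 0\<close> by (simp add: Qk)
qed

end
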